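(* Let $G$ be a finite subgroup of the isometry group $\mathrm{Isom}(\mathbb H^n)$ of hyperbolic $n$-space $\mathbb H^n$. Let $\mathbb H^G=\{x\in\mathbb H^n\mid gx=x\ \forall g\in G\}$ and, for $k>0$, $\mathbb H^G_k=\{x\in\mathbb H^n\mid d(x,gx)\le k\ \forall g\in G\}$. Then $\mathbb H^G$ is coarsely dense in $\mathbb H^G_k$, for any $k>0$.
   Context: A subset $A\subset B$ of a metric space is coarsely dense in $B$ if there is a constant $C$ such that every point of $B$ is within distance $C$ of some point of $A$. *)

theory Defs
  imports "HOL-Analysis.Analysis" "HOL-Algebra.Group"
begin

text \<open>Hyperbolic n-space as the upper sheet of the unit hyperboloid in Minkowski space
  \<open>real \<times> (real ^ 'n)\<close> (the first component is the time coordinate), where n is the cardinality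
  of the index type, with \<open>cosh (d p q) = - \<langle>p, q\<rangle>\<close>.\<close>

definition lorentz :: "real \<times> (real ^ 'n) \<Rightarrow> real \<times> (real ^ 'n) \<Rightarrow> real" where
  "lorentz p q = snd p \<bullet> snd q - fst p * fst q"

typedef ('n::finite) hyperbolic_space =
  "{p :: real \<times> (real ^ 'n). lorentz p p = -1 \<and> fst p > 0}"
  by (rule exI[of _ "(1, 0)"]) (simp add: lorentz_def)

lemma lorentz_commute: "lorentz p q = lorentz q p"
  by (simp add: lorentz_def inner_commute)

lemma lorentz_diff_left: "lorentz (p - q) r = lorentz p r - lorentz q r"
  by (simp add: lorentz_def algebra_simps)

lemma lorentz_scaleR_left: "lorentz (c *\<^sub>R p) r = c * lorentz p r"
  by (simp add: lorentz_def algebra_simps)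

lemma lorentz_diff_right: "lorentz p (q - r) = lorentz p q - lorentz p r"
  by (simp add: lorentz_def algebra_simps)

lemma lorentz_scaleR_right: "lorentz p (c *\<^sub>R r) = c * lorentz p r"
  by (simp add: lorentz_def algebra_simps)

lemma lorentz_add_left: "lorentz (p + q) r = lorentz p r + lorentz q r"
  by (simp add: lorentz_def algebra_simps)

lemma lorentz_add_right: "lorentz p (q + r) = lorentz p q + lorentz p r"
  by (simp add: lorentz_def algebra_simps)

lemmas lorentz_bilinear = lorentz_add_left lorentz_add_right
  lorentz_diff_left lorentz_scaleR_left lorentz_diff_right lorentz_scaleR_right

lemma lorentz_pos_def:
  assumes q: "lorentz q q = -1" "fst q > 0" and w: "lorentz w q = 0"
  shows "lorentz w w \<ge> 0" and "lorentz w w = 0 \<Longrightarrow> w = 0"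
proof -
  let ?s = "fst w" and ?t = "fst q"
  have 1: "snd w \<bullet> snd q = ?s * ?t" using w by (simp add: lorentz_def)
  have 2: "snd q \<bullet> snd q = ?t\<^sup>2 - 1" using q by (simp add: lorentz_def power2_eq_square)
  have 3: "(?s * ?t)\<^sup>2 \<le> (snd w \<bullet> snd w) * (?t\<^sup>2 - 1)"
    using Cauchy_Schwarz_ineq[of "snd w" "snd q"] by (simp add: 1 2)
  have "(?s * ?t)\<^sup>2 + snd w \<bullet> snd w \<le> (snd w \<bullet> snd w) * ?t\<^sup>2"
    using 3 by (simp add: algebra_simps)
  then have 4: "snd w \<bullet> snd w \<le> lorentz w w * ?t\<^sup>2"
    by (simp add: lorentz_def power2_eq_square algebra_simps)
  then have "0 \<le> lorentz w w * ?t\<^sup>2"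
    using inner_ge_zero[of "snd w"] by linarith
  then show "lorentz w w \<ge> 0"
    using q(2) by (simp add: zero_le_mult_iff)
  assume 0: "lorentz w w = 0"
  then have sw: "snd w = 0"
    using 4 inner_ge_zero[of "snd w"] by (simp add: antisym)
  then have "fst w = 0" using 0 by (simp add: lorentz_def)
  with sw show "w = 0" by (simp add: prod_eq_iff)
qed

lemma lorentz_Cauchy_Schwarz:
  assumes q: "lorentz q q = -1" "fst q > 0" and u: "lorentz u q = 0" and v: "lorentz v q = 0"
  shows "(lorentz u v)\<^sup>2 \<le> lorentz u u * lorentz v v"
proof (cases "lorentz v v = 0")
  case True
  then have "v = 0" using lorentz_pos_def(2)[OF q v] by simp
  then show ?thesis by (simp add: lorentz_def)
next
  case False
  then have pos: "lorentz v v > 0" using lorentz_pos_def(1)[OF q v] by simp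
  define w where "w = lorentz v v *\<^sub>R u - lorentz u v *\<^sub>R v"
  have "lorentz w q = 0" by (simp add: w_def lorentz_bilinear u v)
  then have "0 \<le> lorentz w w" by (rule lorentz_pos_def(1)[OF q])
  also have "lorentz w w = lorentz v v * (lorentz u u * lorentz v v - (lorentz u v)\<^sup>2)"
    by (simp add: w_def lorentz_bilinear lorentz_commute[of v u] power2_eq_square algebra_simps)
  finally show ?thesis using pos by (simp add: zero_le_mult_iff)
qed

lemma lorentz_hyperboloid:
  assumes p: "lorentz p p = -1" "fst p > 0" and q: "lorentz q q = -1" "fst q > 0"
  shows "- lorentz p q \<ge> 1" and "lorentz p q = -1 \<Longrightarrow> p = q"
proof -
  define w where "w = p - (- lorentz p q) *\<^sub>R q"
  have wq: "lorentz w q = 0"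
    by (simp add: w_def lorentz_bilinear q)
  have ww: "lorentz w w = (lorentz p q)\<^sup>2 - 1"
    by (simp only: w_def lorentz_bilinear lorentz_commute[of q p] p q)
      (simp add: power2_eq_square algebra_simps)
  have "norm (snd r) < fst r" if "lorentz r r = -1" "fst r > 0" for r :: "real \<times> (real ^ 'a)"
  proof (rule power2_less_imp_less)
    show "(norm (snd r))\<^sup>2 < (fst r)\<^sup>2"
      using that(1) unfolding lorentz_def power2_norm_eq_inner
      unfolding power2_eq_square by linarith
    show "0 \<le> fst r" using that(2) by simp
  qed
  then have "norm (snd p) * norm (snd q) < fst p * fst q"
    using p q by (intro mult_strict_mono') auto
  then have neg: "- lorentz p q > 0"
    using norm_cauchy_schwarz[of "snd p" "snd q"] by (simp add: lorentz_def)
  have "1\<^sup>2 \<le> (- lorentz p q)\<^sup>2"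
    using lorentz_pos_def(1)[OF q wq] ww by simp
  then show "- lorentz p q \<ge> 1"
    using neg by (intro power2_le_imp_le[of 1]) auto
  assume "lorentz p q = -1"
  then have "w = 0" using lorentz_pos_def(2)[OF q wq] ww by simp
  then show "p = q" using \<open>lorentz p q = -1\<close> by (simp add: w_def)
qed

lemma Rep_hyperbolic_space_props:
  "lorentz (Rep_hyperbolic_space x) (Rep_hyperbolic_space x) = -1"
  "fst (Rep_hyperbolic_space x) > 0"
  using Rep_hyperbolic_space[of x] by auto

lemma hyperbolic_triangle:
  assumes p: "lorentz p p = -1" "fst p > 0" and q: "lorentz q q = -1" "fst q > 0"
    and r: "lorentz r r = -1" "fst r > 0"
  shows "arcosh (- lorentz p r) \<le> arcosh (- lorentz p q) + arcosh (- lorentz q r)"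
proof -
  define a b where "a = - lorentz p q" and "b = - lorentz q r"
  define u v where "u = p - a *\<^sub>R q" and "v = r - b *\<^sub>R q"
  have a: "a \<ge> 1" and b: "b \<ge> 1"
    unfolding a_def b_def by (rule lorentz_hyperboloid(1); fact)+
  have c: "- lorentz p r \<ge> 1" by (rule lorentz_hyperboloid(1); fact)
  have uq: "lorentz u q = 0" and vq: "lorentz v q = 0"
    by (simp_all add: u_def v_def lorentz_bilinear a_def b_def q lorentz_commute[of r q])
  have uu: "lorentz u u = a\<^sup>2 - 1" and vv: "lorentz v v = b\<^sup>2 - 1"
    by (simp_all add: u_def v_def lorentz_bilinear a_def b_def p q r lorentz_commute[of r q]
        lorentz_commute[of q p] power2_eq_square algebra_simps)
  have uv: "lorentz u v = lorentz p r + a * b"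
    by (simp add: u_def v_def lorentz_bilinear a_def b_def q algebra_simps)
  have "\<bar>lorentz u v\<bar> \<le> sqrt ((a\<^sup>2 - 1) * (b\<^sup>2 - 1))"
    using real_sqrt_le_mono[OF lorentz_Cauchy_Schwarz[OF q uq vq]]
    by (simp only: uu vv real_sqrt_abs)
  then have "- lorentz p r \<le> a * b + sqrt (a\<^sup>2 - 1) * sqrt (b\<^sup>2 - 1)"
    unfolding uv by (simp add: real_sqrt_mult abs_if split: if_splits)
  also have "\<dots> = cosh (arcosh a + arcosh b)"
    using a b by (simp add: cosh_add sinh_arcosh_real)
  finally have "arcosh (- lorentz p r) \<le> arcosh (cosh (arcosh a + arcosh b))"
    using c less_imp_le[OF arcosh_real_strict_mono] by (metis order_le_less)
  also have "\<dots> = arcosh a + arcosh b"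
    using a b by (intro arcosh_cosh_real) simp
  finally show ?thesis by (simp add: a_def b_def)
qed

instantiation hyperbolic_space :: (finite) metric_space
begin

definition dist_hyperbolic_space :: "'a hyperbolic_space \<Rightarrow> 'a hyperbolic_space \<Rightarrow> real" where
  "dist_hyperbolic_space x y =
     arcosh (- lorentz (Rep_hyperbolic_space x) (Rep_hyperbolic_space y))"

definition uniformity_hyperbolic_space ::
    "('a hyperbolic_space \<times> 'a hyperbolic_space) filter" where
  "uniformity_hyperbolic_space =
     (INF e\<in>{0<..}. principal {(x::'a hyperbolic_space, y). dist x y < e})"

definition open_hyperbolic_space :: "'a hyperbolic_space set \<Rightarrow> bool" where
  "open_hyperbolic_space U \<longleftrightarrow>
     (\<forall>x\<in>U. eventually (\<lambda>(x', y). x' = x \<longrightarrow> y \<in> U) uniformity)"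

instance
proof
  fix x y z :: "'a hyperbolic_space"
  note props = Rep_hyperbolic_space_props
  show "dist x y = 0 \<longleftrightarrow> x = y"
  proof
    assume "dist x y = 0"
    then have "lorentz (Rep_hyperbolic_space x) (Rep_hyperbolic_space y) = -1"
      using lorentz_hyperboloid(1)[OF props[of x] props[of y]]
      by (simp add: dist_hyperbolic_space_def)
    then show "x = y"
      using lorentz_hyperboloid(2)[OF props[of x] props[of y]]
      by (simp add: Rep_hyperbolic_space_inject)
  qed (simp add: dist_hyperbolic_space_def props)
  have "dist x y \<le> dist x z + dist z y"
    unfolding dist_hyperbolic_space_def by (rule hyperbolic_triangle; rule props)
  then show "dist x y \<le> dist x z + dist y z"
    by (simp add: dist_hyperbolic_space_def lorentz_commute)
qed (fact uniformity_hyperbolic_space_def open_hyperbolic_space_def)+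

end

definition isometry_group :: "('a::metric_space \<Rightarrow> 'a) monoid" where
  "isometry_group =
     \<lparr>carrier = {g. bij g \<and> (\<forall>x y. dist (g x) (g y) = dist x y)}, mult = (\<circ>), one = id\<rparr>"

lemma group_isometry_group: "group (isometry_group :: ('a::metric_space \<Rightarrow> 'a) monoid)"
proof (rule groupI)
  fix g :: "'a \<Rightarrow> 'a" assume "g \<in> carrier isometry_group"
  then have g: "bij g" "\<And>x y. dist (g x) (g y) = dist x y"
    by (auto simp: isometry_group_def)
  have "dist (inv_into UNIV g x) (inv_into UNIV g y) = dist x y" for x y
    using g(2)[of "inv_into UNIV g x" "inv_into UNIV g y"] g(1)
    by (simp add: bij_is_surj surj_f_inv_f)
  then show "\<exists>h\<in>carrier isometry_group. h \<otimes>\<^bsub>isometry_group\<^esub> g = \<one>\<^bsub>isometry_group\<^esub>"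
    using g(1)
    by (intro bexI[of _ "inv_into UNIV g"])
      (auto simp: isometry_group_def bij_imp_bij_inv bij_is_inj)
qed (auto simp: isometry_group_def bij_comp)

definition coarsely_dense :: "'a::metric_space set \<Rightarrow> 'a set \<Rightarrow> bool" where
  "coarsely_dense A B \<longleftrightarrow> A \<subseteq> B \<and> (\<exists>C. \<forall>b\<in>B. \<exists>a\<in>A. dist b a \<le> C)"

definition fixed_set :: "('a \<Rightarrow> 'a) set \<Rightarrow> 'a set" where
  "fixed_set G = {x. \<forall>g\<in>G. g x = x}"

definition almost_fixed_set :: "('a::metric_space \<Rightarrow> 'a) set \<Rightarrow> real \<Rightarrow> 'a set" where
  "almost_fixed_set G k = {x. \<forall>g\<in>G. dist x (g x) \<le> k}"

end

theory Submission
  imports Defs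
begin

text \<open>Instead of showing that isometries are linear, use the barycenter of a finite orbit: by
  linearity, \<open>\<Sum>s\<in>S. cosh (d x s)\<close> is a positive multiple of \<open>cosh (d x c)\<close>, where c is the
  normalised vector sum of S. Hence c is the unique minimiser of this sum, so every isometry
  preserving S fixes c. For the orbit S of a point b of the almost fixed set, minimality gives
  \<open>cosh (d c b) \<le> (\<Sum>s\<in>S. cosh (d b s)) \<le> card S * cosh k\<close>.\<close>

lemma lorentz_sum_left: "lorentz (\<Sum>i\<in>A. f i) q = (\<Sum>i\<in>A. lorentz (f i) q)"
  by (induction A rule: infinite_finite_induct)
    (simp_all add: lorentz_add_left, simp_all add: lorentz_def)

lemma lorentz_sum_right: "lorentz p (\<Sum>i\<in>A. f i) = (\<Sum>i\<in>A. lorentz p (f i))"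
  by (simp add: lorentz_commute[of p] lorentz_sum_left)

lemma Rep_hyperbolic_space_lorentz_ge:
  "- lorentz (Rep_hyperbolic_space x) (Rep_hyperbolic_space y) \<ge> 1"
  by (rule lorentz_hyperboloid(1); rule Rep_hyperbolic_space_props)

lemma cosh_dist_hyperbolic_space:
  "cosh (dist x y) = - lorentz (Rep_hyperbolic_space x) (Rep_hyperbolic_space y)"
  unfolding dist_hyperbolic_space_def
  by (rule cosh_arcosh_real) (rule Rep_hyperbolic_space_lorentz_ge)

text \<open>The vector sum \<open>v\<close> of a nonempty finite set of hyperboloid points is
  timelike with positive time coordinate, so it rescales to a point of the hyperboloid. The factor
  \<open>r\<close> is the Lorentzian length of \<open>v\<close> and does not depend on
  \<open>x\<close>.\<close>

lemma hyperbolic_barycenter: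
  fixes S :: "'n::finite hyperbolic_space set"
  assumes S: "finite S" "S \<noteq> {}"
  obtains c r where "r > 0" and "\<And>x. (\<Sum>s\<in>S. cosh (dist x s)) = r * cosh (dist x c)"
proof -
  define v where "v = (\<Sum>s\<in>S. Rep_hyperbolic_space s)"
  define r where "r = sqrt (- lorentz v v)"
  define p where "p = (1 / r) *\<^sub>R v"
  have "fst v = (\<Sum>s\<in>S. fst (Rep_hyperbolic_space s))"
    by (simp add: v_def fst_sum)
  then have fst_v: "fst v > 0"
    using S by (simp add: sum_pos Rep_hyperbolic_space_props)
  \<comment> \<open>Expanding bilinearly shows that \<open>v\<close> is timelike: every term of the
    double sum, diagonal ones included, is at least 1.\<close>
  have "- lorentz v v =
      (\<Sum>s\<in>S. \<Sum>t\<in>S. - lorentz (Rep_hyperbolic_space t) (Rep_hyperbolic_space s))"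
    by (simp add: v_def lorentz_sum_left lorentz_sum_right sum_negf)
  also have "\<dots> > 0"
    using S by (intro sum_pos less_le_trans[OF zero_less_one Rep_hyperbolic_space_lorentz_ge])
  finally have vv: "- lorentz v v > 0" .
  then have r: "r > 0" and rr: "r * r = - lorentz v v"
    by (simp_all add: r_def)
  have "lorentz p p = lorentz v v / (r * r)"
    by (simp add: p_def lorentz_bilinear)
  then have "lorentz p p = -1" "fst p > 0"
    using vv r fst_v unfolding rr by (simp_all add: p_def)
  then have Rep_c: "Rep_hyperbolic_space (Abs_hyperbolic_space p) = p"
    by (simp add: Abs_hyperbolic_space_inverse)
  have "(\<Sum>s\<in>S. cosh (dist x s)) = r * cosh (dist x (Abs_hyperbolic_space p))" for x
  proof -
    have "(\<Sum>s\<in>S. cosh (dist x s)) = - lorentz (Rep_hyperbolic_space x) v"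
      by (simp add: cosh_dist_hyperbolic_space v_def lorentz_sum_right sum_negf)
    also have "v = r *\<^sub>R p"
      using r by (simp add: p_def)
    finally show ?thesis
      by (simp add: cosh_dist_hyperbolic_space Rep_c lorentz_scaleR_right)
  qed
  with r show thesis by (rule that)
qed

theorem proposition5p3:
  fixes G :: "('n::finite hyperbolic_space \<Rightarrow> 'n hyperbolic_space) set"
    and k :: real
  assumes "subgroup G isometry_group" and "finite G" and "k > 0"
  shows "coarsely_dense (fixed_set G) (almost_fixed_set G k)"
proof -
  have iso: "dist (g x) (g y) = dist x y" if "g \<in> G" for g x y
    using subgroup.subset[OF assms(1)] that by (auto simp: isometry_group_def)
  have inj: "inj g" if "g \<in> G" for g
    using subgroup.subset[OF assms(1)] that by (auto simp: isometry_group_def bij_is_inj)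
  have comp: "g \<circ> h \<in> G" if "g \<in> G" "h \<in> G" for g h
    using subgroup.m_closed[OF assms(1) that] by (simp add: isometry_group_def)
  have id: "id \<in> G"
    using subgroup.one_closed[OF assms(1)] by (simp add: isometry_group_def)
  \<comment> \<open>The orbit of \<open>b\<close> may be smaller than \<open>G\<close> and vary in
    size with \<open>b\<close>; using \<open>card G\<close> makes the bound uniform.\<close>
  have "\<exists>a\<in>fixed_set G. dist b a \<le> arcosh (real (card G) * cosh k)"
    if b: "b \<in> almost_fixed_set G k" for b
  proof -
    define S where "S = (\<lambda>g. g b) ` G"
    have S: "finite S" and bS: "b \<in> S"
      using assms(2) id by (auto simp: S_def intro: rev_image_eqI)
    obtain c r where r: "r > 0"
      and sum: "\<And>x. (\<Sum>s\<in>S. cosh (dist x s)) = r * cosh (dist x c)"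
      using hyperbolic_barycenter[of S] S bS by blast
    have "h c = c" if h: "h \<in> G" for h
    proof -
      have inj_S: "inj_on h S"
        using inj[OF h] by (rule inj_on_subset) simp
      have "h ` S \<subseteq> S"
        using comp[OF h] by (auto simp: S_def intro!: rev_image_eqI[of "h \<circ> _"])
      \<comment> \<open>An injective self-map of a finite set is onto.\<close>
      then have image: "h ` S = S"
        using S inj_S by (intro endo_inj_surj)
      \<comment> \<open>Reindexing the orbit by \<open>h\<close> shows that the sum takes the same
        value at \<open>h c\<close> as at \<open>c\<close>, namely \<open>r\<close>, since cosh 0 =
        1.\<close>
      have "r * cosh (dist (h c) c) = (\<Sum>s\<in>h ` S. cosh (dist (h c) s))"
        by (simp add: image sum)
      also have "\<dots> = (\<Sum>s\<in>S. cosh (dist c s))"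
        using inj_S by (simp add: sum.reindex iso[OF h])
      also have "\<dots> = r"
        by (simp add: sum)
      finally have "cosh (dist (h c) c) = 1"
        using r by simp
      then show ?thesis
        by (simp add: cosh_real_one_iff)
    qed
    then have "c \<in> fixed_set G"
      by (simp add: fixed_set_def)
    moreover have "dist b c \<le> arcosh (real (card G) * cosh k)"
    proof -
      \<comment> \<open>Every summand is positive, so the single term at \<open>s = b\<close> is
        bounded by the whole sum.\<close>
      have "cosh (dist b c) \<le> (\<Sum>s\<in>S. cosh (dist c s))"
        using member_le_sum[OF bS, of "\<lambda>s. cosh (dist c s)"] S by (simp add: dist_commute)
      also have "\<dots> = r * 1"
        by (simp add: sum)
      also have "\<dots> \<le> r * cosh (dist b c)"
        using r by (intro mult_left_mono cosh_real_ge_1) simp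
      also have "\<dots> = (\<Sum>s\<in>S. cosh (dist b s))"
        by (simp add: sum)
      \<comment> \<open>Each orbit point is within \<open>k\<close> of \<open>b\<close>, and cosh is
        increasing on nonnegative reals.\<close>
      also have "\<dots> \<le> real (card S) * cosh k"
        using b assms(3)
        by (intro sum_bounded_above) (auto simp: S_def almost_fixed_set_def cosh_real_nonneg_le_iff)
      also have "\<dots> \<le> real (card G) * cosh k"
        using assms(2) by (intro mult_right_mono) (simp_all add: S_def card_image_le)
      finally have le: "cosh (dist b c) \<le> real (card G) * cosh k" .
      have "dist b c = arcosh (cosh (dist b c))"
        by (simp add: arcosh_cosh_real)
      \<comment> \<open>Monotonicity of arcosh is available only from 1 upwards, hence the lower
        bound on cosh.\<close>
      also have "\<dots> \<le> arcosh (real (card G) * cosh k)"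
        using le cosh_real_ge_1[of "dist b c"] arcosh_real_strict_mono by (metis order_le_less)
      finally show ?thesis .
    qed
    ultimately show ?thesis by blast
  qed
  moreover have "fixed_set G \<subseteq> almost_fixed_set G k"
    using assms(3) by (auto simp: fixed_set_def almost_fixed_set_def)
  ultimately show ?thesis
    unfolding coarsely_dense_def by blast
qed

end
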